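(* Let $M$ be a manifold and let $\mathcal{S}^1$ and $\mathcal{S}^2$ be sheaves of smooth sections of fibre bundles $\pi_{B_1}$ and $\pi_{B_2}$ over $M$ respectively. Suppose that $\tilde F:\mathcal{S}^1\to\mathcal{S}^2$ is a morphism of sheaves for which the induced map $\mathcal{S}^1_{\mathrm{loc}}\to\mathcal{S}^2_{\mathrm{loc}}$ is smooth with respect to the functional diffeologies. Then the formula $$F\big(x,[\sigma]^{\mathrm g}_x\big):=\big(x,[\tilde F(\sigma)]^{\mathrm g}_x\big),\qquad (x,[\sigma]^{\mathrm g}_x)\in\Gamma_{\mathrm g}(\mathcal{S}^1),$$ defines a morphism $F:\Gamma_{\mathrm g}(\mathcal{S}^1)\to\Gamma_{\mathrm g}(\mathcal{S}^2)$ of diffeological pseudo-bundles over $M$ (i.e. a smooth map commuting with the projections to $M$).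
   Context: A diffeology on a set is a family of maps (plots) from open subsets of finite-dimensional Euclidean spaces which contains all constant maps, is local, and is closed under precomposition with smooth maps between open Euclidean sets. A map is smooth if composition with it sends plots to plots. Subsets, quotients and products carry the subspace, quotient and product diffeologies. A diffeological pseudo-bundle is a subduction, i.e. a surjection whose target has the pushforward diffeology. Sheaves of sections $\mathcal{S}$ of a fibre bundle over $M$ are assumed locally nonempty: each $x\in M$ has an open neighbourhood $\mathcal{O}$ with $\mathcal{S}(\mathcal{O})\neq\emptyset$. The total space is $\mathcal{S}_{\mathrm{loc}}:=\bigcup_{\mathcal{O}}\mathcal{S}(\mathcal{O})$, the set of all local sections (with their domains) belonging to $\mathcal{S}$. Its functional diffeology: $\tilde\sigma:U\to\mathcal{S}_{\mathrm{loc}}$ is a plot iff for all $u_0\in U$ and $x_0\in\mathrm{dom}(\tilde\sigma(u_0))$ there are open neighbourhoods $V\subset U$ of $u_0$ and $\mathcal{O}\subset\mathrm{dom}(\tilde\sigma(u_0))$ of $x_0$ with $\mathcal{O}\subset\mathrm{dom}(\tilde\sigma(u))$ for all $u\in V$ and $V\times\mathcal{O}\ni(u,x)\mapsto\tilde\sigma(u)(x)$ smooth. $\Gamma_{\mathrm{loc}}(\mathcal{S}):=\{(x,\sigma)\in M\times\mathcal{S}_{\mathrm{loc}}:x\in\mathrm{dom}(\sigma)\}$ (subspace diffeology), and $\Gamma_{\mathrm g}(\mathcal{S})$ is its diffeological quotient by $(x,\sigma)\sim(y,\eta)$ iff $x=y$ and the germs $[\sigma]^{\mathrm g}_x=[\eta]^{\mathrm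 g}_x$ agree. The projection $(x,[\sigma]^{\mathrm g}_x)\mapsto x$ makes it a diffeological pseudo-bundle over $M$, the pseudo-bundle of germs of $\mathcal{S}$. *)

theory Defs
  imports "HOL-Analysis.Analysis"
begin

section \<open>Smooth maps between open subsets of Euclidean spaces\<close>

text \<open>
  Plots have domains in \<open>\<real>\<^sup>n\<close> for every \<open>n\<close>, so \<open>n\<close> cannot be a type here: \<open>\<real>\<^sup>n\<close> is the
  library's \<^const>\<open>Euclidean_space\<close>, whose points are the functions \<open>nat \<Rightarrow> real\<close> vanishing from
  \<open>n\<close> on.
  \<open>Ck_on k n U f\<close>, for \<open>U\<close> open in \<open>\<real>\<^sup>n\<close>: all iterated partial derivatives of \<open>f\<close> of order at most
  \<open>k\<close> exist and are continuous on \<open>U\<close>. Only the values of \<open>f\<close> on \<open>U\<close> matter.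
\<close>

primrec Ck_on :: "nat \<Rightarrow> nat \<Rightarrow> (nat \<Rightarrow> real) set \<Rightarrow> ((nat \<Rightarrow> real) \<Rightarrow> real) \<Rightarrow> bool" where
  "Ck_on 0 n U f \<longleftrightarrow> continuous_map (subtopology (Euclidean_space n) U) euclideanreal f"
| "Ck_on (Suc k) n U f \<longleftrightarrow>
     continuous_map (subtopology (Euclidean_space n) U) euclideanreal f \<and>
     (\<forall>i<n. \<exists>g. Ck_on k n U g \<and>
        (\<forall>x\<in>U. ((\<lambda>t. f (x(i := t))) has_real_derivative g x) (at (x i))))"

definition smooth_Rn ::
    "nat \<Rightarrow> (nat \<Rightarrow> real) set \<Rightarrow> nat \<Rightarrow> ((nat \<Rightarrow> real) \<Rightarrow> (nat \<Rightarrow> real)) \<Rightarrow> bool" where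
  "smooth_Rn n U m f \<longleftrightarrow>
     f ` U \<subseteq> topspace (Euclidean_space m) \<and> (\<forall>j<m. \<forall>k. Ck_on k n U (\<lambda>x. f x j))"


section \<open>Diffeological spaces\<close>

text \<open>
  \<open>is_plot X n U p\<close>: \<open>U\<close> is open in \<open>\<real>\<^sup>n\<close> and the restriction of \<open>p\<close> to \<open>U\<close> is a plot of \<open>X\<close>;
  the values of \<open>p\<close> outside \<open>U\<close> are irrelevant. The record carries data only and does not
  impose the axioms of a diffeology: the spaces used are Euclidean spaces, manifolds, function
  spaces and their subspaces, products and quotients, each given by its concrete plots.
\<close>

record 'a dspace =
  points :: "'a set"
  is_plot :: "nat \<Rightarrow> (nat \<Rightarrow> real) set \<Rightarrow> ((nat \<Rightarrow> real) \<Rightarrow> 'a) \<Rightarrow> bool"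

definition smooth_map :: "'a dspace \<Rightarrow> 'b dspace \<Rightarrow> ('a \<Rightarrow> 'b) \<Rightarrow> bool" where
  "smooth_map X Y f \<longleftrightarrow>
     f ` points X \<subseteq> points Y \<and> (\<forall>n U p. is_plot X n U p \<longrightarrow> is_plot Y n U (f \<circ> p))"

definition diffeomorphism :: "'a dspace \<Rightarrow> 'b dspace \<Rightarrow> ('a \<Rightarrow> 'b) \<Rightarrow> bool" where
  "diffeomorphism X Y f \<longleftrightarrow>
     bij_betw f (points X) (points Y) \<and> smooth_map X Y f \<and>
     smooth_map Y X (inv_into (points X) f)"

definition subspace_of :: "'a dspace \<Rightarrow> 'a set \<Rightarrow> 'a dspace" where
  "subspace_of X A =
     \<lparr> points = points X \<inter> A,
       is_plot = (\<lambda>n U p. is_plot X n U p \<and> p ` U \<subseteq> A) \<rparr>"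

definition product_of :: "'a dspace \<Rightarrow> 'b dspace \<Rightarrow> ('a \<times> 'b) dspace" where
  "product_of X Y =
     \<lparr> points = points X \<times> points Y,
       is_plot = (\<lambda>n U p. is_plot X n U (fst \<circ> p) \<and> is_plot Y n U (snd \<circ> p)) \<rparr>"

text \<open>
  The image of \<open>q\<close> with the pushforward diffeology, i.e. the quotient of \<open>X\<close> by the relation
  \<open>q a = q b\<close>, the class of \<open>a\<close> being represented by \<open>q a\<close>.
\<close>

definition pushforward :: "'a dspace \<Rightarrow> ('a \<Rightarrow> 'b) \<Rightarrow> 'b dspace" where
  "pushforward X q =
     \<lparr> points = q ` points X,
       is_plot = (\<lambda>n U p. openin (Euclidean_space n) U \<and>
         (\<forall>u\<in>U. \<exists>V r. openin (Euclidean_space n) V \<and> u \<in> V \<and> V \<subseteq> U \<and>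
            is_plot X n V r \<and> (\<forall>v\<in>V. p v = q (r v)))) \<rparr>"

definition subduction :: "'a dspace \<Rightarrow> 'b dspace \<Rightarrow> ('a \<Rightarrow> 'b) \<Rightarrow> bool" where
  "subduction X Y q \<longleftrightarrow> q ` points X = points Y \<and> is_plot Y = is_plot (pushforward X q)"

definition pseudo_bundle :: "'e dspace \<Rightarrow> 'm dspace \<Rightarrow> ('e \<Rightarrow> 'm) \<Rightarrow> bool" where
  "pseudo_bundle E M pr \<longleftrightarrow> subduction E M pr"

definition pseudo_bundle_morphism ::
    "'m dspace \<Rightarrow> 'e dspace \<Rightarrow> ('e \<Rightarrow> 'm) \<Rightarrow> 'f dspace \<Rightarrow> ('f \<Rightarrow> 'm) \<Rightarrow> ('e \<Rightarrow> 'f) \<Rightarrow> bool" where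
  "pseudo_bundle_morphism M E pr E' pr' F \<longleftrightarrow>
     pseudo_bundle E M pr \<and> pseudo_bundle E' M pr' \<and>
     smooth_map E E' F \<and> (\<forall>e\<in>points E. pr' (F e) = pr e)"

definition Rn_space :: "nat \<Rightarrow> (nat \<Rightarrow> real) dspace" where
  "Rn_space m =
     \<lparr> points = topspace (Euclidean_space m),
       is_plot = (\<lambda>n U p. openin (Euclidean_space n) U \<and> smooth_Rn n U m p) \<rparr>"


section \<open>Manifolds and fibre bundles\<close>

text \<open>A chart is a pair of its open domain and its coordinate map.\<close>

record 'a manifold =
  mtop :: "'a topology"
  mdim :: nat
  atlas :: "('a set \<times> ('a \<Rightarrow> nat \<Rightarrow> real)) set"

definition smooth_manifold :: "'a manifold \<Rightarrow> bool" where
  "smooth_manifold M \<longleftrightarrow>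
     Hausdorff_space (mtop M) \<and> second_countable (mtop M) \<and>
     (\<Union>(W, \<phi>)\<in>atlas M. W) = topspace (mtop M) \<and>
     (\<forall>(W, \<phi>)\<in>atlas M.
        openin (mtop M) W \<and> openin (Euclidean_space (mdim M)) (\<phi> ` W) \<and>
        homeomorphic_map (subtopology (mtop M) W)
          (subtopology (Euclidean_space (mdim M)) (\<phi> ` W)) \<phi>) \<and>
     (\<forall>(W, \<phi>)\<in>atlas M. \<forall>(W', \<phi>')\<in>atlas M.
        smooth_Rn (mdim M) (\<phi> ` (W \<inter> W')) (mdim M) (\<phi>' \<circ> inv_into W \<phi>))"

text \<open>The manifold diffeology: its plots are the maps that are smooth in charts.\<close>

definition man_space :: "'a manifold \<Rightarrow> 'a dspace" where
  "man_space M =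
     \<lparr> points = topspace (mtop M),
       is_plot = (\<lambda>n U p. openin (Euclidean_space n) U \<and>
         continuous_map (subtopology (Euclidean_space n) U) (mtop M) p \<and>
         (\<forall>(W, \<phi>)\<in>atlas M. smooth_Rn n {u\<in>U. p u \<in> W} (mdim M) (\<phi> \<circ> p))) \<rparr>"

text \<open>\<open>fibre_bundle M B Q \<pi>\<close>: \<open>\<pi> : B \<rightarrow> M\<close> is a smooth fibre bundle with typical fibre \<open>Q\<close>.\<close>

definition fibre_bundle :: "'m manifold \<Rightarrow> 'b manifold \<Rightarrow> 'q manifold \<Rightarrow> ('b \<Rightarrow> 'm) \<Rightarrow> bool" where
  "fibre_bundle M B Q \<pi> \<longleftrightarrow>
     smooth_manifold M \<and> smooth_manifold B \<and> smooth_manifold Q \<and>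
     smooth_map (man_space B) (man_space M) \<pi> \<and>
     \<pi> ` points (man_space B) = points (man_space M) \<and>
     (\<forall>x\<in>topspace (mtop M). \<exists>W \<psi>. openin (mtop M) W \<and> x \<in> W \<and>
        diffeomorphism (subspace_of (man_space B) {b. \<pi> b \<in> W})
          (product_of (subspace_of (man_space M) W) (man_space Q)) \<psi> \<and>
        (\<forall>b\<in>topspace (mtop B). \<pi> b \<in> W \<longrightarrow> fst (\<psi> b) = \<pi> b))"


section \<open>Sheaves of smooth sections\<close>

text \<open>Local sections are partial maps, so that a section determines its domain.\<close>

definition smooth_sections ::
    "'m manifold \<Rightarrow> 'b manifold \<Rightarrow> ('b \<Rightarrow> 'm) \<Rightarrow> 'm set \<Rightarrow> ('m \<rightharpoonup> 'b) set" where
  "smooth_sections M B \<pi> W =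
     {\<sigma>. dom \<sigma> = W \<and>
        smooth_map (subspace_of (man_space M) W) (man_space B) (\<lambda>x. the (\<sigma> x)) \<and>
        (\<forall>x\<in>W. \<pi> (the (\<sigma> x)) = x)}"

type_synonym ('m, 'b) sections = "'m set \<Rightarrow> ('m \<rightharpoonup> 'b) set"

definition S_loc :: "'m manifold \<Rightarrow> ('m, 'b) sections \<Rightarrow> ('m \<rightharpoonup> 'b) set" where
  "S_loc M S = (\<Union>W\<in>{W. openin (mtop M) W}. S W)"

text \<open>
  In the gluing axiom the family is indexed by the local sections themselves, each of which
  knows its domain; uniqueness of the glued section is automatic.
\<close>

definition sheaf_of_smooth_sections ::
    "'m manifold \<Rightarrow> 'b manifold \<Rightarrow> ('b \<Rightarrow> 'm) \<Rightarrow> ('m, 'b) sections \<Rightarrow> bool" where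
  "sheaf_of_smooth_sections M B \<pi> S \<longleftrightarrow>
     (\<forall>W. openin (mtop M) W \<longrightarrow> S W \<subseteq> smooth_sections M B \<pi> W) \<and>
     (\<forall>W W' \<sigma>. openin (mtop M) W \<and> openin (mtop M) W' \<and> W' \<subseteq> W \<and> \<sigma> \<in> S W \<longrightarrow> \<sigma> |` W' \<in> S W') \<and>
     (\<forall>A. A \<subseteq> S_loc M S \<and>
        (\<forall>\<sigma>\<in>A. \<forall>\<tau>\<in>A. \<sigma> |` (dom \<sigma> \<inter> dom \<tau>) = \<tau> |` (dom \<sigma> \<inter> dom \<tau>)) \<longrightarrow>
        (\<exists>\<rho>\<in>S (\<Union>\<sigma>\<in>A. dom \<sigma>). \<forall>\<sigma>\<in>A. \<rho> |` dom \<sigma> = \<sigma>))"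

definition locally_nonempty :: "'m manifold \<Rightarrow> ('m, 'b) sections \<Rightarrow> bool" where
  "locally_nonempty M S \<longleftrightarrow>
     (\<forall>x\<in>topspace (mtop M). \<exists>W. openin (mtop M) W \<and> x \<in> W \<and> S W \<noteq> {})"

definition sheaf_morphism ::
    "'m manifold \<Rightarrow> ('m, 'b) sections \<Rightarrow> ('m, 'c) sections \<Rightarrow>
     ('m set \<Rightarrow> ('m \<rightharpoonup> 'b) \<Rightarrow> ('m \<rightharpoonup> 'c)) \<Rightarrow> bool" where
  "sheaf_morphism M S S' F \<longleftrightarrow>
     (\<forall>W \<sigma>. openin (mtop M) W \<and> \<sigma> \<in> S W \<longrightarrow> F W \<sigma> \<in> S' W) \<and>
     (\<forall>W W' \<sigma>. openin (mtop M) W \<and> openin (mtop M) W' \<and> W' \<subseteq> W \<and> \<sigma> \<in> S W \<longrightarrow>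
        F W' (\<sigma> |` W') = F W \<sigma> |` W')"

definition induced_loc ::
    "('m set \<Rightarrow> ('m \<rightharpoonup> 'b) \<Rightarrow> ('m \<rightharpoonup> 'c)) \<Rightarrow> ('m \<rightharpoonup> 'b) \<Rightarrow> ('m \<rightharpoonup> 'c)" where
  "induced_loc F \<sigma> = F (dom \<sigma>) \<sigma>"

definition functional_space ::
    "'m manifold \<Rightarrow> 'b manifold \<Rightarrow> ('m, 'b) sections \<Rightarrow> ('m \<rightharpoonup> 'b) dspace" where
  "functional_space M B S =
     \<lparr> points = S_loc M S,
       is_plot = (\<lambda>n U s. openin (Euclidean_space n) U \<and> s ` U \<subseteq> S_loc M S \<and>
         (\<forall>u0\<in>U. \<forall>x0\<in>dom (s u0). \<exists>V W.
            openin (Euclidean_space n) V \<and> u0 \<in> V \<and> V \<subseteq> U \<and>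
            openin (mtop M) W \<and> x0 \<in> W \<and> W \<subseteq> dom (s u0) \<and>
            (\<forall>u\<in>V. W \<subseteq> dom (s u)) \<and>
            smooth_map
              (product_of (subspace_of (Rn_space n) V) (subspace_of (man_space M) W))
              (man_space B) (\<lambda>(u, x). the (s u x)))) \<rparr>"


section \<open>The pseudo-bundle of germs\<close>

definition Gamma_loc ::
    "'m manifold \<Rightarrow> 'b manifold \<Rightarrow> ('m, 'b) sections \<Rightarrow> ('m \<times> ('m \<rightharpoonup> 'b)) dspace" where
  "Gamma_loc M B S =
     subspace_of (product_of (man_space M) (functional_space M B S)) {(x, \<sigma>). x \<in> dom \<sigma>}"

definition same_germ :: "'m manifold \<Rightarrow> 'm \<Rightarrow> ('m \<rightharpoonup> 'b) \<Rightarrow> ('m \<rightharpoonup> 'b) \<Rightarrow> bool" where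
  "same_germ M x \<sigma> \<eta> \<longleftrightarrow>
     (\<exists>W. openin (mtop M) W \<and> x \<in> W \<and> W \<subseteq> dom \<sigma> \<inter> dom \<eta> \<and> \<sigma> |` W = \<eta> |` W)"

definition germ :: "'m manifold \<Rightarrow> ('m, 'b) sections \<Rightarrow> 'm \<Rightarrow> ('m \<rightharpoonup> 'b) \<Rightarrow> ('m \<rightharpoonup> 'b) set" where
  "germ M S x \<sigma> = {\<eta>\<in>S_loc M S. same_germ M x \<sigma> \<eta>}"

text \<open>
  The relation \<open>x = y\<close> and \<open>germ M S x \<sigma> = germ M S y \<eta>\<close> on \<^const>\<open>Gamma_loc\<close> is the kernel of
  \<open>(x, \<sigma>) \<mapsto> (x, germ M S x \<sigma>)\<close>, so the quotient is the pushforward along this map, and the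
  projection to \<open>M\<close> is \<^const>\<open>fst\<close>.
\<close>

definition Gamma_germ ::
    "'m manifold \<Rightarrow> 'b manifold \<Rightarrow> ('m, 'b) sections \<Rightarrow> ('m \<times> ('m \<rightharpoonup> 'b) set) dspace" where
  "Gamma_germ M B S = pushforward (Gamma_loc M B S) (\<lambda>(x, \<sigma>). (x, germ M S x \<sigma>))"

end

theory Submission
  imports Defs
begin

text \<open>
  A sheaf morphism commutes with restriction, so it maps two sections that agree near \<open>x\<close> to two
  sections that agree near \<open>x\<close>. The map \<open>(x, \<sigma>) \<mapsto> (x, Ft \<sigma>)\<close> on pointed local sections therefore
  descends to germs (\<open>germ_induced_loc_eq\<close>). It is smooth because its first component is the
  identity and its second is smooth by assumption, and it stays in \<^const>\<open>Gamma_loc\<close> because a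
  sheaf morphism preserves domains (\<open>smooth_map_Gamma_loc\<close>). By the universal property of
  quotients (\<open>smooth_map_pushforward\<close>) the map on germs is smooth, and it visibly covers the
  identity of \<open>M\<close>.

  That the projections of the germ spaces are subductions is also to be shown. As quotients
  compose, one may argue with the projection of \<^const>\<open>Gamma_loc\<close> instead. Its plots project to
  plots of \<open>M\<close>, and being a plot of \<open>M\<close> is a local property (\<open>man_space_plot_local\<close>). Conversely, a
  plot \<open>p\<close> of \<open>M\<close> lifts near each parameter to \<open>u \<mapsto> (p u, \<sigma>)\<close>, where \<open>\<sigma>\<close> is one fixed section
  around the given point; it exists by local nonemptiness, and a constant family is a plot of the
  functional diffeology.
\<close>

section \<open>Smoothness is a local property\<close>

lemma continuous_map_local:
  assumes "openin X U"
    and loc: "\<And>u. u \<in> U \<Longrightarrow> \<exists>V g. openin X V \<and> u \<in> V \<and> V \<subseteq> U \<and> (\<forall>v\<in>V. f v = g v) \<and>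
                continuous_map (subtopology X V) Y g"
  shows "continuous_map (subtopology X U) Y f"
proof -
  have top: "topspace (subtopology X U) = U"
    using openin_subset[OF assms(1)] by auto
  have "f u \<in> topspace Y" if u: "u \<in> U" for u
  proof -
    obtain V g where V: "openin X V" "u \<in> V" "\<forall>v\<in>V. f v = g v"
      "continuous_map (subtopology X V) Y g"
      using loc[OF u] by blast
    have "u \<in> topspace (subtopology X V)"
      using openin_subset[OF V(1)] V(2) by auto
    then have "g u \<in> topspace Y"
      using V(4) by (auto simp: continuous_map_def)
    then show ?thesis using V by simp
  qed
  moreover have "openin (subtopology X U) {u \<in> U. f u \<in> G}" if G: "openin Y G" for G
  proof -
    have "\<exists>T. openin X T \<and> u \<in> T \<and> T \<subseteq> {u \<in> U. f u \<in> G}" if u: "u \<in> U" "f u \<in> G" for u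
    proof -
      obtain V g where V: "openin X V" "u \<in> V" "V \<subseteq> U" "\<forall>v\<in>V. f v = g v"
        "continuous_map (subtopology X V) Y g"
        using loc[OF u(1)] by blast
      have "openin (subtopology X V) {v \<in> topspace (subtopology X V). g v \<in> G}"
        by (rule openin_continuous_map_preimage[OF V(5) G])
      also have "{v \<in> topspace (subtopology X V). g v \<in> G} = {v \<in> V. f v \<in> G}"
        using openin_subset[OF V(1)] V(4) by auto
      finally have "openin X {v \<in> V. f v \<in> G}"
        using V(1) by (simp add: openin_open_subtopology)
      then show ?thesis
        using V u by (intro exI[of _ "{v \<in> V. f v \<in> G}"]) auto
    qed
    then have "openin X {u \<in> U. f u \<in> G}"
      by (subst openin_subopen) auto
    then show ?thesis
      using assms(1) by (auto simp: openin_open_subtopology)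
  qed
  ultimately show ?thesis
    unfolding continuous_map_def top by blast
qed

text \<open>
  This is why the partial derivative in direction \<open>i < n\<close> at a point of an open set depends only on
  the values in that set; for \<open>i \<ge> n\<close> the updated point would leave \<open>\<real>\<^sup>n\<close>.
\<close>

lemma eventually_update_in_openin_Euclidean:
  assumes "openin (Euclidean_space n) U" "x \<in> U" "i < n"
  shows "eventually (\<lambda>t. x(i := t) \<in> U) (nhds (x i))"
proof -
  have x: "x \<in> topspace (Euclidean_space n)"
    using assms openin_subset by blast
  have "continuous_map euclideanreal (Euclidean_space n) (\<lambda>t. x(i := t))"
    unfolding Euclidean_space_def continuous_map_in_subtopology
  proof
    show "continuous_map euclideanreal (powertop_real UNIV) (\<lambda>t. x(i := t))"
      unfolding continuous_map_componentwise_UNIV by (simp add: fun_upd_apply)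
    show "(\<lambda>t. x(i := t)) \<in> topspace euclideanreal \<rightarrow> {x. \<forall>i\<ge>n. x i = 0}"
      using x assms(3) by (auto simp: topspace_Euclidean_space)
  qed
  from openin_continuous_map_preimage[OF this assms(1)]
  have "open {t. x(i := t) \<in> U}" by simp
  then show ?thesis
    using assms(2) by (auto simp: eventually_nhds)
qed

lemma Ck_on_subset:
  assumes "V \<subseteq> U" "Ck_on k n U f"
  shows "Ck_on k n V f"
  using assms(2)
proof (induction k arbitrary: f)
  case 0
  then show ?case
    using assms(1) by (auto intro: continuous_map_from_subtopology_mono)
next
  case (Suc k)
  then have "continuous_map (subtopology (Euclidean_space n) V) euclideanreal f"
    using assms(1) by (auto intro: continuous_map_from_subtopology_mono)
  moreover have "\<exists>g. Ck_on k n V g \<and>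
      (\<forall>x\<in>V. ((\<lambda>t. f (x(i := t))) has_real_derivative g x) (at (x i)))" if i: "i < n" for i
  proof -
    obtain g where g: "Ck_on k n U g"
      "\<forall>x\<in>U. ((\<lambda>t. f (x(i := t))) has_real_derivative g x) (at (x i))"
      using Suc.prems i by auto
    have "Ck_on k n V g"
      by (rule Suc.IH[OF g(1)])
    moreover have "\<forall>x\<in>V. ((\<lambda>t. f (x(i := t))) has_real_derivative g x) (at (x i))"
      by (intro ballI bspec[OF g(2)] subsetD[OF assms(1)])
    ultimately show ?thesis by blast
  qed
  ultimately show ?case by simp
qed

text \<open>
  Partial derivatives are unique, so the derivatives given on the small open sets are
  restrictions of one global function, to which induction applies. The local functions may
  differ from \<open>f\<close> outside the small sets: since these are open, this does not affect derivatives.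
\<close>

lemma Ck_on_local:
  assumes "openin (Euclidean_space n) U"
    and "\<And>u. u \<in> U \<Longrightarrow> \<exists>V h. openin (Euclidean_space n) V \<and> u \<in> V \<and> V \<subseteq> U \<and>
               (\<forall>v\<in>V. f v = h v) \<and> Ck_on k n V h"
  shows "Ck_on k n U f"
  using assms(2)
proof (induction k arbitrary: f)
  case 0
  show ?case
    unfolding Ck_on.simps(1)
    by (rule continuous_map_local[OF assms(1)]) (use 0 in simp)
next
  case (Suc k)
  have cont: "continuous_map (subtopology (Euclidean_space n) U) euclideanreal f"
  proof (rule continuous_map_local[OF assms(1)])
    fix u assume "u \<in> U"
    from Suc.prems[OF this] show "\<exists>V g. openin (Euclidean_space n) V \<and> u \<in> V \<and> V \<subseteq> U \<and>
        (\<forall>v\<in>V. f v = g v) \<and> continuous_map (subtopology (Euclidean_space n) V) euclideanreal g"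
      unfolding Ck_on.simps(2) by blast
  qed
  have "\<exists>g. Ck_on k n U g \<and>
      (\<forall>x\<in>U. ((\<lambda>t. f (x(i := t))) has_real_derivative g x) (at (x i)))" if i: "i < n" for i
  proof -
    define g where "g x = deriv (\<lambda>t. f (x(i := t))) (x i)" for x
    have loc: "\<exists>V g'. openin (Euclidean_space n) V \<and> u \<in> V \<and> V \<subseteq> U \<and> (\<forall>v\<in>V. g v = g' v) \<and>
        Ck_on k n V g' \<and> (\<forall>x\<in>V. ((\<lambda>t. f (x(i := t))) has_real_derivative g' x) (at (x i)))"
      if u: "u \<in> U" for u
    proof -
      obtain V h where V: "openin (Euclidean_space n) V" "u \<in> V" "V \<subseteq> U" "\<forall>v\<in>V. f v = h v"
        "Ck_on (Suc k) n V h"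
        using Suc.prems[OF u] by blast
      obtain g' where g': "Ck_on k n V g'"
        "\<forall>x\<in>V. ((\<lambda>t. h (x(i := t))) has_real_derivative g' x) (at (x i))"
        using V(5) i by auto
      have der: "((\<lambda>t. f (x(i := t))) has_real_derivative g' x) (at (x i))" if x: "x \<in> V" for x
      proof -
        have "eventually (\<lambda>t. x(i := t) \<in> V) (nhds (x i))"
          by (rule eventually_update_in_openin_Euclidean[OF V(1) x i])
        then have "eventually (\<lambda>t. h (x(i := t)) = f (x(i := t))) (nhds (x i))"
          by eventually_elim (use V(4) in simp)
        from DERIV_cong_ev[OF refl this refl] show ?thesis
          using g'(2) x by blast
      qed
      moreover have "\<forall>v\<in>V. g v = g' v"
        unfolding g_def using der by (auto intro: DERIV_imp_deriv)
      ultimately show ?thesis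
        using V g' by blast
    qed
    have "Ck_on k n U g"
    proof (rule Suc.IH)
      fix u assume "u \<in> U"
      from loc[OF this] obtain V g' where "openin (Euclidean_space n) V" "u \<in> V" "V \<subseteq> U"
        "\<forall>v\<in>V. g v = g' v" "Ck_on k n V g'"
        by (elim exE conjE)
      then show "\<exists>V h. openin (Euclidean_space n) V \<and> u \<in> V \<and> V \<subseteq> U \<and>
          (\<forall>v\<in>V. g v = h v) \<and> Ck_on k n V h"
        by (intro exI conjI)
    qed
    moreover have "((\<lambda>t. f (x(i := t))) has_real_derivative g x) (at (x i))" if x: "x \<in> U" for x
    proof -
      from loc[OF x] obtain V g' where V: "x \<in> V" "\<forall>v\<in>V. g v = g' v"
        "\<forall>x\<in>V. ((\<lambda>t. f (x(i := t))) has_real_derivative g' x) (at (x i))"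
        by (elim exE conjE)
      from V(3) V(1) have "((\<lambda>t. f (x(i := t))) has_real_derivative g' x) (at (x i))"
        by (rule bspec)
      then show ?thesis
        using V(1,2) by simp
    qed
    ultimately show ?thesis by blast
  qed
  with cont show ?case by simp
qed

lemma smooth_Rn_subset:
  assumes "V \<subseteq> U" "smooth_Rn n U m f"
  shows "smooth_Rn n V m f"
  using assms by (auto simp: smooth_Rn_def intro: Ck_on_subset[OF assms(1)])

lemma smooth_Rn_local:
  assumes "openin (Euclidean_space n) U"
    and loc: "\<And>u. u \<in> U \<Longrightarrow> \<exists>V h. openin (Euclidean_space n) V \<and> u \<in> V \<and> V \<subseteq> U \<and>
               (\<forall>v\<in>V. f v = h v) \<and> smooth_Rn n V m h"
  shows "smooth_Rn n U m f"
  unfolding smooth_Rn_def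
proof (intro conjI allI impI)
  show "f ` U \<subseteq> topspace (Euclidean_space m)"
  proof clarify
    fix u assume "u \<in> U"
    from loc[OF this] obtain V h where "u \<in> V" "\<forall>v\<in>V. f v = h v" "smooth_Rn n V m h"
      by blast
    then show "f u \<in> topspace (Euclidean_space m)"
      unfolding smooth_Rn_def by auto
  qed
next
  fix j k assume j: "j < m"
  show "Ck_on k n U (\<lambda>x. f x j)"
  proof (rule Ck_on_local[OF assms(1)])
    fix u assume "u \<in> U"
    from loc[OF this] obtain V h where V: "openin (Euclidean_space n) V" "u \<in> V" "V \<subseteq> U"
      "\<forall>v\<in>V. f v = h v" "smooth_Rn n V m h"
      by blast
    then show "\<exists>V h. openin (Euclidean_space n) V \<and> u \<in> V \<and> V \<subseteq> U \<and>
        (\<forall>v\<in>V. f v j = h v) \<and> Ck_on k n V h"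
      using j by (intro exI[of _ V] exI[of _ "\<lambda>x. h x j"]) (auto simp: smooth_Rn_def)
  qed
qed

section \<open>Plots of a manifold\<close>

lemma smooth_manifold_chart_open:
  assumes "smooth_manifold M" "(W, \<phi>) \<in> atlas M"
  shows "openin (mtop M) W"
proof -
  have "\<forall>(W, \<phi>)\<in>atlas M. openin (mtop M) W \<and> openin (Euclidean_space (mdim M)) (\<phi> ` W) \<and>
      homeomorphic_map (subtopology (mtop M) W)
        (subtopology (Euclidean_space (mdim M)) (\<phi> ` W)) \<phi>"
    using assms(1) unfolding smooth_manifold_def by (elim conjE)
  from bspec[OF this assms(2)] show ?thesis
    by simp
qed

lemma man_space_plot_preimage_open:
  assumes "is_plot (man_space M) n U p" "openin (mtop M) W"
  shows "openin (Euclidean_space n) {u \<in> U. p u \<in> W}"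
proof -
  have U: "openin (Euclidean_space n) U"
    and p: "continuous_map (subtopology (Euclidean_space n) U) (mtop M) p"
    using assms(1) by (auto simp: man_space_def)
  have "openin (subtopology (Euclidean_space n) U)
          {u \<in> topspace (subtopology (Euclidean_space n) U). p u \<in> W}"
    by (rule openin_continuous_map_preimage[OF p assms(2)])
  moreover have "topspace (subtopology (Euclidean_space n) U) = U"
    using openin_subset[OF U] by auto
  ultimately show ?thesis
    by (simp only: openin_open_subtopology[OF U])
qed

lemma man_space_plot_subset:
  assumes "is_plot (man_space M) n U p" "openin (Euclidean_space n) V" "V \<subseteq> U"
  shows "is_plot (man_space M) n V p"
proof -
  have "smooth_Rn n {u\<in>V. p u \<in> W} (mdim M) (\<phi> \<circ> p)" if "(W, \<phi>) \<in> atlas M" for W \<phi>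
    by (rule smooth_Rn_subset[of _ "{u\<in>U. p u \<in> W}"])
      (use assms that in \<open>auto simp: man_space_def\<close>)
  moreover have "continuous_map (subtopology (Euclidean_space n) V) (mtop M) p"
    by (rule continuous_map_from_subtopology_mono[OF _ assms(3)])
      (use assms(1) in \<open>simp add: man_space_def\<close>)
  ultimately show ?thesis
    using assms(2) by (auto simp: man_space_def)
qed

lemma man_space_plot_in_points:
  assumes "is_plot (man_space M) n U p" "u \<in> U"
  shows "p u \<in> topspace (mtop M)"
proof -
  have U: "openin (Euclidean_space n) U"
    and p: "continuous_map (subtopology (Euclidean_space n) U) (mtop M) p"
    using assms(1) by (auto simp: man_space_def)
  have "topspace (subtopology (Euclidean_space n) U) = U"
    using openin_subset[OF U] by auto
  with continuous_map_image_subset_topspace[OF p] assms(2) show ?thesis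
    by blast
qed

text \<open>
  The chart condition is about the preimage of a chart domain, which is covered by the open
  preimages under the local plots; on each of these the local smoothness applies.
\<close>

lemma man_space_plot_local:
  assumes M: "smooth_manifold M"
    and U: "openin (Euclidean_space n) U"
    and loc: "\<And>u. u \<in> U \<Longrightarrow> \<exists>V r. openin (Euclidean_space n) V \<and> u \<in> V \<and> V \<subseteq> U \<and>
                (\<forall>v\<in>V. p v = r v) \<and> is_plot (man_space M) n V r"
  shows "is_plot (man_space M) n U p"
proof -
  have cont: "continuous_map (subtopology (Euclidean_space n) U) (mtop M) p"
  proof (rule continuous_map_local[OF U])
    fix u assume "u \<in> U"
    from loc[OF this] obtain V r where V: "openin (Euclidean_space n) V" "u \<in> V" "V \<subseteq> U"
      "\<forall>v\<in>V. p v = r v" "is_plot (man_space M) n V r"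
      by (elim exE conjE)
    have "continuous_map (subtopology (Euclidean_space n) V) (mtop M) r"
      using V(5) by (simp add: man_space_def)
    with V(1-4) show "\<exists>V g. openin (Euclidean_space n) V \<and> u \<in> V \<and> V \<subseteq> U \<and>
        (\<forall>v\<in>V. p v = g v) \<and> continuous_map (subtopology (Euclidean_space n) V) (mtop M) g"
      by (intro exI conjI)
  qed
  have "smooth_Rn n {u\<in>U. p u \<in> W} (mdim M) (\<phi> \<circ> p)" if ch: "(W, \<phi>) \<in> atlas M" for W \<phi>
  proof -
    have W: "openin (mtop M) W"
      by (rule smooth_manifold_chart_open[OF M ch])
    have shrink: "\<exists>V h. openin (Euclidean_space n) V \<and> u \<in> V \<and> V \<subseteq> {u\<in>U. p u \<in> W} \<and>
        (\<forall>v\<in>V. (\<phi> \<circ> p) v = h v) \<and> smooth_Rn n V (mdim M) h" if u: "u \<in> U" "p u \<in> W" for u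
    proof -
      obtain V r where V: "openin (Euclidean_space n) V" "u \<in> V" "V \<subseteq> U"
        "\<forall>v\<in>V. p v = r v" "is_plot (man_space M) n V r"
        using loc[OF u(1)] by (elim exE conjE)
      have "openin (Euclidean_space n) {v\<in>V. r v \<in> W}"
        by (rule man_space_plot_preimage_open[OF V(5) W])
      moreover have "smooth_Rn n {v\<in>V. r v \<in> W} (mdim M) (\<phi> \<circ> r)"
        using V(5) ch by (auto simp: man_space_def)
      moreover have "u \<in> {v\<in>V. r v \<in> W}" "{v\<in>V. r v \<in> W} \<subseteq> {u\<in>U. p u \<in> W}"
        "\<forall>v\<in>{v\<in>V. r v \<in> W}. (\<phi> \<circ> p) v = (\<phi> \<circ> r) v"
        using V(2-4) u(2) by auto
      ultimately show ?thesis
        by (intro exI conjI)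
    qed
    have "\<exists>V. openin (Euclidean_space n) V \<and> u \<in> V \<and> V \<subseteq> {u\<in>U. p u \<in> W}"
      if u: "u \<in> {u\<in>U. p u \<in> W}" for u
    proof -
      have "u \<in> U" "p u \<in> W" using u by auto
      from shrink[OF this] show ?thesis
        by (elim exE conjE) (intro exI conjI)
    qed
    then have "openin (Euclidean_space n) {u\<in>U. p u \<in> W}"
      by (subst openin_subopen) blast
    then show ?thesis
    proof (rule smooth_Rn_local)
      fix u assume "u \<in> {u\<in>U. p u \<in> W}"
      then have "u \<in> U" "p u \<in> W" by auto
      then show "\<exists>V h. openin (Euclidean_space n) V \<and> u \<in> V \<and> V \<subseteq> {u\<in>U. p u \<in> W} \<and>
          (\<forall>v\<in>V. (\<phi> \<circ> p) v = h v) \<and> smooth_Rn n V (mdim M) h"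
        by (rule shrink)
    qed
  qed
  with U cont show ?thesis
    by (auto simp: man_space_def)
qed

section \<open>Quotients of diffeological spaces\<close>

lemma is_plot_pushforwardE:
  assumes "is_plot (pushforward X q) n U p" "u \<in> U"
  obtains V r where "openin (Euclidean_space n) V" "u \<in> V" "V \<subseteq> U" "is_plot X n V r"
    "\<forall>v\<in>V. p v = q (r v)"
proof -
  have "\<exists>V r. openin (Euclidean_space n) V \<and> u \<in> V \<and> V \<subseteq> U \<and>
      is_plot X n V r \<and> (\<forall>v\<in>V. p v = q (r v))"
    using assms by (simp add: pushforward_def)
  then show ?thesis
    using that by blast
qed

text \<open>
  Lifting a plot through \<open>h\<close> and then through \<open>q\<close> only shrinks the domain twice. Hence the
  projection of a quotient is a subduction as soon as its composite with the quotient map is.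
\<close>

lemma is_plot_pushforward_pushforward:
  "is_plot (pushforward (pushforward X q) h) = is_plot (pushforward X (h \<circ> q))"
proof (intro ext iffI)
  fix n U p
  assume L: "is_plot (pushforward (pushforward X q) h) n U p"
  then have U: "openin (Euclidean_space n) U"
    by (simp add: pushforward_def)
  have "\<exists>V r. openin (Euclidean_space n) V \<and> u \<in> V \<and> V \<subseteq> U \<and>
      is_plot X n V r \<and> (\<forall>v\<in>V. p v = (h \<circ> q) (r v))" if u: "u \<in> U" for u
  proof -
    obtain V r where V: "openin (Euclidean_space n) V" "u \<in> V" "V \<subseteq> U"
      "is_plot (pushforward X q) n V r" "\<forall>v\<in>V. p v = h (r v)"
      by (rule is_plot_pushforwardE[OF L u])
    obtain V' r' where "openin (Euclidean_space n) V'" "u \<in> V'" "V' \<subseteq> V"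
      "is_plot X n V' r'" "\<forall>v\<in>V'. r v = q (r' v)"
      by (rule is_plot_pushforwardE[OF V(4,2)])
    with V show ?thesis
      by (intro exI[of _ V'] exI[of _ r']) auto
  qed
  with U show "is_plot (pushforward X (h \<circ> q)) n U p"
    by (simp add: pushforward_def)
next
  fix n U p
  assume R: "is_plot (pushforward X (h \<circ> q)) n U p"
  then have U: "openin (Euclidean_space n) U"
    by (simp add: pushforward_def)
  have "\<exists>V r. openin (Euclidean_space n) V \<and> u \<in> V \<and> V \<subseteq> U \<and>
      is_plot (pushforward X q) n V r \<and> (\<forall>v\<in>V. p v = h (r v))" if u: "u \<in> U" for u
  proof -
    obtain V r where V: "openin (Euclidean_space n) V" "u \<in> V" "V \<subseteq> U" "is_plot X n V r"
      "\<forall>v\<in>V. p v = h (q (r v))"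
      by (rule is_plot_pushforwardE[OF R u, unfolded comp_apply])
    then have "is_plot (pushforward X q) n V (q \<circ> r)"
      by (auto simp: pushforward_def)
    with V show ?thesis
      by (intro exI[of _ V] exI[of _ "q \<circ> r"]) auto
  qed
  with U show "is_plot (pushforward (pushforward X q) h) n U p"
    by (simp add: pushforward_def)
qed

text \<open>
  The assumption on the plots of \<open>X\<close> is an axiom of diffeologies, which \<^typ>\<open>'a dspace\<close> does not
  impose; without it the square need not commute along a plot.
\<close>

lemma smooth_map_pushforward:
  assumes plots: "\<And>n U r u. is_plot X n U r \<Longrightarrow> u \<in> U \<Longrightarrow> r u \<in> points X"
    and f: "smooth_map X Y f"
    and comm: "\<And>x. x \<in> points X \<Longrightarrow> F (q x) = q' (f x)"
  shows "smooth_map (pushforward X q) (pushforward Y q') F"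
  unfolding smooth_map_def
proof (intro conjI allI impI)
  show "F ` points (pushforward X q) \<subseteq> points (pushforward Y q')"
    using f comm by (auto simp: pushforward_def smooth_map_def)
next
  fix n U p
  assume p: "is_plot (pushforward X q) n U p"
  then have U: "openin (Euclidean_space n) U"
    by (simp add: pushforward_def)
  have "\<exists>V r. openin (Euclidean_space n) V \<and> u \<in> V \<and> V \<subseteq> U \<and>
      is_plot Y n V r \<and> (\<forall>v\<in>V. (F \<circ> p) v = q' (r v))" if u: "u \<in> U" for u
  proof -
    obtain V r where V: "openin (Euclidean_space n) V" "u \<in> V" "V \<subseteq> U" "is_plot X n V r"
      "\<forall>v\<in>V. p v = q (r v)"
      by (rule is_plot_pushforwardE[OF p u])
    moreover have "is_plot Y n V (f \<circ> r)"
      using f V(4) by (simp add: smooth_map_def)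
    moreover have "\<forall>v\<in>V. (F \<circ> p) v = q' ((f \<circ> r) v)"
      using V(5) comm plots[OF V(4)] by simp
    ultimately show ?thesis by blast
  qed
  with U show "is_plot (pushforward Y q') n U (F \<circ> p)"
    by (simp add: pushforward_def)
qed

section \<open>The projection of the space of germs\<close>

lemma points_Gamma_loc:
  "points (Gamma_loc M B S) = {(x, \<sigma>). x \<in> topspace (mtop M) \<and> \<sigma> \<in> S_loc M S \<and> x \<in> dom \<sigma>}"
  by (auto simp: Gamma_loc_def subspace_of_def product_of_def man_space_def functional_space_def)

lemma is_plot_Gamma_loc:
  "is_plot (Gamma_loc M B S) n U r \<longleftrightarrow>
     is_plot (man_space M) n U (fst \<circ> r) \<and> is_plot (functional_space M B S) n U (snd \<circ> r) \<and>
     (\<forall>u\<in>U. fst (r u) \<in> dom (snd (r u)))"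
  by (simp add: Gamma_loc_def subspace_of_def product_of_def case_prod_beta image_subset_iff
      conj_assoc)

lemma Gamma_loc_plot_in_points:
  assumes "is_plot (Gamma_loc M B S) n U r" "u \<in> U"
  shows "r u \<in> points (Gamma_loc M B S)"
proof -
  have "is_plot (man_space M) n U (fst \<circ> r)" "snd (r u) \<in> S_loc M S" "fst (r u) \<in> dom (snd (r u))"
    using assms by (auto simp: is_plot_Gamma_loc functional_space_def image_subset_iff)
  moreover have "fst (r u) \<in> topspace (mtop M)"
    using man_space_plot_in_points[OF calculation(1) assms(2)] by simp
  ultimately show ?thesis
    by (simp add: points_Gamma_loc case_prod_beta)
qed

lemma sheaf_section_dom:
  assumes "sheaf_of_smooth_sections M B \<pi> S" "openin (mtop M) W" "\<sigma> \<in> S W"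
  shows "dom \<sigma> = W"
  using assms by (auto simp: sheaf_of_smooth_sections_def smooth_sections_def)

lemma sheaf_S_loc_iff:
  assumes "sheaf_of_smooth_sections M B \<pi> S"
  shows "\<sigma> \<in> S_loc M S \<longleftrightarrow> openin (mtop M) (dom \<sigma>) \<and> \<sigma> \<in> S (dom \<sigma>)"
  using sheaf_section_dom[OF assms] by (auto simp: S_loc_def)

text \<open>
  Evaluation of a constant family factors through the projection to \<open>M\<close>, and \<open>\<sigma>\<close> itself is smooth;
  the neighbourhoods demanded by the functional diffeology are \<open>U\<close> and the whole domain of \<open>\<sigma>\<close>.
\<close>

lemma functional_space_const_plot:
  assumes S: "sheaf_of_smooth_sections M B \<pi> S" and \<sigma>: "\<sigma> \<in> S_loc M S"
    and U: "openin (Euclidean_space n) U"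
  shows "is_plot (functional_space M B S) n U (\<lambda>_. \<sigma>)"
proof -
  have dom: "openin (mtop M) (dom \<sigma>)" "\<sigma> \<in> S (dom \<sigma>)"
    using \<sigma> sheaf_S_loc_iff[OF S] by auto
  then have sm: "smooth_map (subspace_of (man_space M) (dom \<sigma>)) (man_space B) (\<lambda>x. the (\<sigma> x))"
    using S by (auto simp: sheaf_of_smooth_sections_def smooth_sections_def)
  have "smooth_map (product_of (subspace_of (Rn_space n) U) (subspace_of (man_space M) (dom \<sigma>)))
          (man_space B) (\<lambda>(u, x). the (\<sigma> x))"
    unfolding smooth_map_def
  proof (intro conjI allI impI)
    show "(\<lambda>(u, x). the (\<sigma> x)) ` points (product_of (subspace_of (Rn_space n) U)
            (subspace_of (man_space M) (dom \<sigma>))) \<subseteq> points (man_space B)"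
      using sm unfolding smooth_map_def by (fastforce simp: product_of_def)
  next
    fix k V c
    assume "is_plot (product_of (subspace_of (Rn_space n) U)
              (subspace_of (man_space M) (dom \<sigma>))) k V c"
    then have "is_plot (subspace_of (man_space M) (dom \<sigma>)) k V (snd \<circ> c)"
      by (simp add: product_of_def)
    then have "is_plot (man_space B) k V ((\<lambda>x. the (\<sigma> x)) \<circ> (snd \<circ> c))"
      using sm by (simp add: smooth_map_def)
    also have "(\<lambda>x. the (\<sigma> x)) \<circ> (snd \<circ> c) = (\<lambda>(u, x). the (\<sigma> x)) \<circ> c"
      by (auto simp: case_prod_beta)
    finally show "is_plot (man_space B) k V ((\<lambda>(u, x). the (\<sigma> x)) \<circ> c)" .
  qed
  then show ?thesis
    using \<sigma> U dom(1) by (auto simp: functional_space_def)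
qed

lemma locally_nonempty_section:
  assumes "sheaf_of_smooth_sections M B \<pi> S" "locally_nonempty M S" "x \<in> topspace (mtop M)"
  obtains \<sigma> where "\<sigma> \<in> S_loc M S" "x \<in> dom \<sigma>"
proof -
  obtain W \<sigma> where W: "openin (mtop M) W" "x \<in> W" "\<sigma> \<in> S W"
    using assms(2,3) unfolding locally_nonempty_def by blast
  then have "\<sigma> \<in> S_loc M S" "x \<in> dom \<sigma>"
    using sheaf_section_dom[OF assms(1)] by (auto simp: S_loc_def)
  then show ?thesis by (rule that)
qed

text \<open>
  Near a parameter \<open>u\<close>, a plot \<open>p\<close> of \<open>M\<close> is lifted by pairing it with a fixed section \<open>\<sigma>\<close> around
  \<open>p u\<close>. The lift lives where \<open>p\<close> stays in the domain of \<open>\<sigma>\<close>, so it is only local.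
\<close>

lemma subduction_Gamma_loc:
  assumes M: "smooth_manifold M" and S: "sheaf_of_smooth_sections M B \<pi> S"
    and ne: "locally_nonempty M S"
  shows "subduction (Gamma_loc M B S) (man_space M) fst"
  unfolding subduction_def
proof
  show "fst ` points (Gamma_loc M B S) = points (man_space M)"
  proof
    show "points (man_space M) \<subseteq> fst ` points (Gamma_loc M B S)"
    proof
      fix x assume "x \<in> points (man_space M)"
      then have x: "x \<in> topspace (mtop M)"
        by (simp add: man_space_def)
      then obtain \<sigma> where "\<sigma> \<in> S_loc M S" "x \<in> dom \<sigma>"
        using locally_nonempty_section[OF S ne] by blast
      with x have "(x, \<sigma>) \<in> points (Gamma_loc M B S)"
        by (simp add: points_Gamma_loc)
      then show "x \<in> fst ` points (Gamma_loc M B S)"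
        by force
    qed
  qed (auto simp: points_Gamma_loc man_space_def)
  show "is_plot (man_space M) = is_plot (pushforward (Gamma_loc M B S) fst)"
  proof (intro ext iffI)
    fix n U p
    assume p: "is_plot (man_space M) n U p"
    then have U: "openin (Euclidean_space n) U"
      by (simp add: man_space_def)
    have "\<exists>V r. openin (Euclidean_space n) V \<and> u \<in> V \<and> V \<subseteq> U \<and>
        is_plot (Gamma_loc M B S) n V r \<and> (\<forall>v\<in>V. p v = fst (r v))" if u: "u \<in> U" for u
    proof -
      obtain \<sigma> where \<sigma>: "\<sigma> \<in> S_loc M S" "p u \<in> dom \<sigma>"
        using locally_nonempty_section[OF S ne man_space_plot_in_points[OF p u]] by blast
      let ?V = "{v \<in> U. p v \<in> dom \<sigma>}"
      have V: "openin (Euclidean_space n) ?V"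
        by (rule man_space_plot_preimage_open[OF p]) (use \<sigma> sheaf_S_loc_iff[OF S] in blast)
      have "is_plot (man_space M) n ?V p"
        by (rule man_space_plot_subset[OF p V]) blast
      moreover have "is_plot (functional_space M B S) n ?V (\<lambda>_. \<sigma>)"
        by (rule functional_space_const_plot[OF S \<sigma>(1) V])
      ultimately have "is_plot (Gamma_loc M B S) n ?V (\<lambda>v. (p v, \<sigma>))"
        by (auto simp: is_plot_Gamma_loc o_def)
      then show ?thesis
        using V u \<sigma>(2) by (intro exI[of _ ?V] exI[of _ "\<lambda>v. (p v, \<sigma>)"]) auto
    qed
    with U show "is_plot (pushforward (Gamma_loc M B S) fst) n U p"
      by (simp add: pushforward_def)
  next
    fix n U p
    assume p: "is_plot (pushforward (Gamma_loc M B S) fst) n U p"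
    then have U: "openin (Euclidean_space n) U"
      by (simp add: pushforward_def)
    show "is_plot (man_space M) n U p"
    proof (rule man_space_plot_local[OF M U])
      fix u assume u: "u \<in> U"
      obtain V r where V: "openin (Euclidean_space n) V" "u \<in> V" "V \<subseteq> U"
        "is_plot (Gamma_loc M B S) n V r" "\<forall>v\<in>V. p v = fst (r v)"
        by (rule is_plot_pushforwardE[OF p u])
      then show "\<exists>V r. openin (Euclidean_space n) V \<and> u \<in> V \<and> V \<subseteq> U \<and>
          (\<forall>v\<in>V. p v = r v) \<and> is_plot (man_space M) n V r"
        by (intro exI[of _ V] exI[of _ "fst \<circ> r"]) (auto simp: is_plot_Gamma_loc)
    qed
  qed
qed

lemma pseudo_bundle_Gamma_germ:
  assumes "smooth_manifold M" "sheaf_of_smooth_sections M B \<pi> S" "locally_nonempty M S"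
  shows "pseudo_bundle (Gamma_germ M B S) (man_space M) fst"
proof -
  define q where "q = (\<lambda>(x, \<sigma>). (x, germ M S x \<sigma>))"
  have G: "Gamma_germ M B S = pushforward (Gamma_loc M B S) q"
    by (simp add: Gamma_germ_def q_def)
  have q: "fst \<circ> q = fst"
    by (auto simp: q_def)
  have sub: "fst ` points (Gamma_loc M B S) = points (man_space M)"
    "is_plot (man_space M) = is_plot (pushforward (Gamma_loc M B S) fst)"
    using subduction_Gamma_loc[OF assms] unfolding subduction_def by blast+
  have "fst ` points (Gamma_germ M B S) = (fst \<circ> q) ` points (Gamma_loc M B S)"
    by (simp add: G pushforward_def image_comp)
  also have "\<dots> = points (man_space M)"
    unfolding q by (rule sub(1))
  finally have "fst ` points (Gamma_germ M B S) = points (man_space M)" .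
  moreover have "is_plot (man_space M) = is_plot (pushforward (Gamma_germ M B S) fst)"
    unfolding G is_plot_pushforward_pushforward q by (rule sub(2))
  ultimately show ?thesis
    unfolding pseudo_bundle_def subduction_def by (rule conjI)
qed

section \<open>The action of a sheaf morphism on germs\<close>

lemma same_germ_sym: "same_germ M x \<sigma> \<eta> \<Longrightarrow> same_germ M x \<eta> \<sigma>"
  by (auto simp: same_germ_def)

lemma same_germ_trans:
  assumes "same_germ M x \<sigma> \<eta>" "same_germ M x \<eta> \<rho>"
  shows "same_germ M x \<sigma> \<rho>"
proof -
  obtain V W where V: "openin (mtop M) V" "x \<in> V" "V \<subseteq> dom \<sigma> \<inter> dom \<eta>" "\<sigma> |` V = \<eta> |` V"
    and W: "openin (mtop M) W" "x \<in> W" "W \<subseteq> dom \<eta> \<inter> dom \<rho>" "\<eta> |` W = \<rho> |` W"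
    using assms unfolding same_germ_def by blast
  have "\<sigma> |` (V \<inter> W) = \<eta> |` (V \<inter> W)"
    using arg_cong[OF V(4), of "\<lambda>f. f |` W"] by simp
  also have "\<dots> = \<rho> |` (V \<inter> W)"
    using arg_cong[OF W(4), of "\<lambda>f. f |` V"] by (simp add: Int_commute)
  finally show ?thesis
    using V W unfolding same_germ_def by (intro exI[of _ "V \<inter> W"]) auto
qed

text \<open>
  The section \<open>\<sigma>\<close> must be defined near \<open>x\<close>, for otherwise its germ set is empty and does not
  determine anything.
\<close>

lemma germ_eq_iff_same_germ:
  assumes "sheaf_of_smooth_sections M B \<pi> S"
    and "\<sigma> \<in> S_loc M S" "x \<in> dom \<sigma>"
  shows "germ M S x \<eta> = germ M S x \<sigma> \<longleftrightarrow> same_germ M x \<eta> \<sigma>"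
proof
  have "openin (mtop M) (dom \<sigma>)"
    using assms(2) sheaf_S_loc_iff[OF assms(1)] by blast
  then have "same_germ M x \<sigma> \<sigma>"
    unfolding same_germ_def using assms(3) by blast
  then have "\<sigma> \<in> germ M S x \<sigma>"
    using assms(2) by (simp add: germ_def)
  moreover assume "germ M S x \<eta> = germ M S x \<sigma>"
  ultimately have "\<sigma> \<in> germ M S x \<eta>"
    by simp
  then show "same_germ M x \<eta> \<sigma>"
    by (simp add: germ_def)
next
  assume g: "same_germ M x \<eta> \<sigma>"
  have "same_germ M x \<eta> \<rho> \<longleftrightarrow> same_germ M x \<sigma> \<rho>" for \<rho>
    using same_germ_trans[OF g] same_germ_trans[OF same_germ_sym[OF g]] by iprover
  then show "germ M S x \<eta> = germ M S x \<sigma>"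
    by (simp add: germ_def)
qed

lemma induced_loc_in_S_loc:
  assumes "sheaf_of_smooth_sections M B1 \<pi>1 S1" "sheaf_of_smooth_sections M B2 \<pi>2 S2"
    and "sheaf_morphism M S1 S2 Ft" "\<sigma> \<in> S_loc M S1"
  shows "induced_loc Ft \<sigma> \<in> S_loc M S2" "dom (induced_loc Ft \<sigma>) = dom \<sigma>"
proof -
  have \<sigma>: "openin (mtop M) (dom \<sigma>)" "\<sigma> \<in> S1 (dom \<sigma>)"
    using assms(4) sheaf_S_loc_iff[OF assms(1)] by auto
  then have F\<sigma>: "induced_loc Ft \<sigma> \<in> S2 (dom \<sigma>)"
    using assms(3) by (simp add: sheaf_morphism_def induced_loc_def)
  with \<sigma>(1) show "induced_loc Ft \<sigma> \<in> S_loc M S2"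
    by (auto simp: S_loc_def)
  show "dom (induced_loc Ft \<sigma>) = dom \<sigma>"
    by (rule sheaf_section_dom[OF assms(2) \<sigma>(1) F\<sigma>])
qed

text \<open>
  Restrict to a neighbourhood \<open>W\<close> of \<open>x\<close> on which the sections agree: both images
  restrict to the image of the common restriction.
\<close>

lemma germ_induced_loc_eq:
  assumes S1: "sheaf_of_smooth_sections M B1 \<pi>1 S1" and S2: "sheaf_of_smooth_sections M B2 \<pi>2 S2"
    and Ft: "sheaf_morphism M S1 S2 Ft"
    and \<sigma>: "\<sigma> \<in> S_loc M S1" "x \<in> dom \<sigma>" and \<eta>: "\<eta> \<in> S_loc M S1"
    and eq: "germ M S1 x \<eta> = germ M S1 x \<sigma>"
  shows "germ M S2 x (induced_loc Ft \<eta>) = germ M S2 x (induced_loc Ft \<sigma>)"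
proof -
  have "same_germ M x \<eta> \<sigma>"
    using eq germ_eq_iff_same_germ[OF S1 \<sigma>] by simp
  then obtain W where W: "openin (mtop M) W" "x \<in> W" "W \<subseteq> dom \<eta> \<inter> dom \<sigma>" "\<eta> |` W = \<sigma> |` W"
    unfolding same_germ_def by blast
  have restrict: "induced_loc Ft \<rho> |` W = Ft W (\<rho> |` W)"
    if "\<rho> \<in> S_loc M S1" "W \<subseteq> dom \<rho>" for \<rho>
  proof -
    have "openin (mtop M) (dom \<rho>)" "\<rho> \<in> S1 (dom \<rho>)"
      using that(1) sheaf_S_loc_iff[OF S1] by auto
    then have "Ft W (\<rho> |` W) = Ft (dom \<rho>) \<rho> |` W"
      using conjunct2[OF Ft[unfolded sheaf_morphism_def]] W(1) that(2) by blast
    then show ?thesis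
      by (simp add: induced_loc_def)
  qed
  note F\<sigma> = induced_loc_in_S_loc[OF S1 S2 Ft \<sigma>(1)]
    and F\<eta> = induced_loc_in_S_loc[OF S1 S2 Ft \<eta>]
  have "induced_loc Ft \<eta> |` W = induced_loc Ft \<sigma> |` W"
    using restrict[OF \<eta>] restrict[OF \<sigma>(1)] W by simp
  moreover have "W \<subseteq> dom (induced_loc Ft \<eta>) \<inter> dom (induced_loc Ft \<sigma>)"
    unfolding F\<sigma>(2) F\<eta>(2) by (rule W(3))
  ultimately have "same_germ M x (induced_loc Ft \<eta>) (induced_loc Ft \<sigma>)"
    unfolding same_germ_def using W(1,2) by (intro exI conjI)
  moreover have "x \<in> dom (induced_loc Ft \<sigma>)"
    unfolding F\<sigma>(2) by (rule \<sigma>(2))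
  ultimately show ?thesis
    using germ_eq_iff_same_germ[OF S2 F\<sigma>(1)] by simp
qed

lemma smooth_map_Gamma_loc:
  assumes S1: "sheaf_of_smooth_sections M B1 \<pi>1 S1" and S2: "sheaf_of_smooth_sections M B2 \<pi>2 S2"
    and Ft: "sheaf_morphism M S1 S2 Ft"
    and sm: "smooth_map (functional_space M B1 S1) (functional_space M B2 S2) (induced_loc Ft)"
  shows "smooth_map (Gamma_loc M B1 S1) (Gamma_loc M B2 S2) (\<lambda>(x, \<sigma>). (x, induced_loc Ft \<sigma>))"
  unfolding smooth_map_def
proof (intro conjI allI impI)
  let ?f = "\<lambda>(x, \<sigma>). (x, induced_loc Ft \<sigma>)"
  show pts: "?f ` points (Gamma_loc M B1 S1) \<subseteq> points (Gamma_loc M B2 S2)"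
    unfolding image_subset_iff points_Gamma_loc
    by (simp add: case_prod_beta induced_loc_in_S_loc[OF S1 S2 Ft] del: domIff)
  fix n U r
  assume r: "is_plot (Gamma_loc M B1 S1) n U r"
  have "fst \<circ> (?f \<circ> r) = fst \<circ> r" and snd: "snd \<circ> (?f \<circ> r) = induced_loc Ft \<circ> (snd \<circ> r)"
    by (auto simp: case_prod_beta)
  then have "is_plot (man_space M) n U (fst \<circ> (?f \<circ> r))"
    using r by (simp add: is_plot_Gamma_loc)
  moreover have "is_plot (functional_space M B2 S2) n U (snd \<circ> (?f \<circ> r))"
    unfolding snd using r sm by (simp add: is_plot_Gamma_loc smooth_map_def)
  moreover have "\<forall>u\<in>U. (?f \<circ> r) u \<in> points (Gamma_loc M B2 S2)"
    using pts Gamma_loc_plot_in_points[OF r] by (simp add: image_subset_iff)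
  then have "\<forall>u\<in>U. fst ((?f \<circ> r) u) \<in> dom (snd ((?f \<circ> r) u))"
    unfolding points_Gamma_loc by (simp add: case_prod_beta)
  ultimately show "is_plot (Gamma_loc M B2 S2) n U (?f \<circ> r)"
    by (simp only: is_plot_Gamma_loc simp_thms)
qed

theorem proposition3p10:
  fixes M :: "'m manifold"
    and B1 :: "'b1 manifold" and Q1 :: "'q1 manifold" and \<pi>1 :: "'b1 \<Rightarrow> 'm"
    and B2 :: "'b2 manifold" and Q2 :: "'q2 manifold" and \<pi>2 :: "'b2 \<Rightarrow> 'm"
    and S1 :: "('m, 'b1) sections" and S2 :: "('m, 'b2) sections"
    and Ft :: "'m set \<Rightarrow> ('m \<rightharpoonup> 'b1) \<Rightarrow> ('m \<rightharpoonup> 'b2)"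
  assumes "smooth_manifold M"
    and "fibre_bundle M B1 Q1 \<pi>1" and "fibre_bundle M B2 Q2 \<pi>2"
    and "sheaf_of_smooth_sections M B1 \<pi>1 S1" and "locally_nonempty M S1"
    and "sheaf_of_smooth_sections M B2 \<pi>2 S2" and "locally_nonempty M S2"
    and "sheaf_morphism M S1 S2 Ft"
    and "smooth_map (functional_space M B1 S1) (functional_space M B2 S2) (induced_loc Ft)"
  shows "\<exists>F. (\<forall>(x, \<sigma>)\<in>points (Gamma_loc M B1 S1).
                F (x, germ M S1 x \<sigma>) = (x, germ M S2 x (induced_loc Ft \<sigma>))) \<and>
             pseudo_bundle_morphism (man_space M)
               (Gamma_germ M B1 S1) fst (Gamma_germ M B2 S2) fst F"
proof -
  note M = assms(1) and S1 = assms(4) and S2 = assms(6) and Ft = assms(8)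
  \<comment> \<open>A germ is sent to the germ of the image of some representative; which one does not matter,
    by \<open>germ_induced_loc_eq\<close>.\<close>
  define rep where "rep x g = (SOME \<sigma>. \<sigma> \<in> S_loc M S1 \<and> germ M S1 x \<sigma> = g)" for x g
  define F where "F = (\<lambda>(x, g). (x, germ M S2 x (induced_loc Ft (rep x g))))"
  have F: "F (x, germ M S1 x \<sigma>) = (x, germ M S2 x (induced_loc Ft \<sigma>))"
    if "(x, \<sigma>) \<in> points (Gamma_loc M B1 S1)" for x \<sigma>
  proof -
    have \<sigma>: "\<sigma> \<in> S_loc M S1" "x \<in> dom \<sigma>"
      using that by (auto simp: points_Gamma_loc)
    let ?\<eta> = "rep x (germ M S1 x \<sigma>)"
    have "?\<eta> \<in> S_loc M S1 \<and> germ M S1 x ?\<eta> = germ M S1 x \<sigma>"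
      unfolding rep_def by (rule someI[of _ \<sigma>]) (use \<sigma> in simp)
    then have "germ M S2 x (induced_loc Ft ?\<eta>) = germ M S2 x (induced_loc Ft \<sigma>)"
      using germ_induced_loc_eq[OF S1 S2 Ft \<sigma>] by blast
    then show ?thesis
      by (simp add: F_def)
  qed
  have "smooth_map (Gamma_germ M B1 S1) (Gamma_germ M B2 S2) F"
    unfolding Gamma_germ_def
  proof (rule smooth_map_pushforward)
    show "smooth_map (Gamma_loc M B1 S1) (Gamma_loc M B2 S2) (\<lambda>(x, \<sigma>). (x, induced_loc Ft \<sigma>))"
      by (rule smooth_map_Gamma_loc[OF S1 S2 Ft assms(9)])
  qed (use F Gamma_loc_plot_in_points in \<open>auto simp: case_prod_beta\<close>)
  moreover have "\<forall>e\<in>points (Gamma_germ M B1 S1). fst (F e) = fst e"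
    by (simp add: F_def case_prod_beta)
  ultimately have "pseudo_bundle_morphism (man_space M)
      (Gamma_germ M B1 S1) fst (Gamma_germ M B2 S2) fst F"
    unfolding pseudo_bundle_morphism_def
    using pseudo_bundle_Gamma_germ[OF M S1 assms(5)] pseudo_bundle_Gamma_germ[OF M S2 assms(7)]
    by blast
  with F show ?thesis
    by blast
qed

end
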